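(* For any $\theta_1,\dots,\theta_p\in\mathbb{S}^{d-1}$, $\mathcal{E}_p$ is $\frac1n$-semi-concave, i.e. $Y\mapsto\mathcal{E}_p(Y)-\frac1n\|Y\|_F^2$ is concave on $\mathbb{R}^{n\times d}$.
   Context: Let $n,d,p\ge1$. A matrix $Y\in\mathbb{R}^{n\times d}$ is written $Y=(y_1,\dots,y_n)^T$ with rows $y_k\in\mathbb{R}^d$, and $\gamma_Y:=\frac1n\sum_{k=1}^n\delta_{y_k}$. Fix $Z\in\mathbb{R}^{n\times d}$. With $P_\theta(x)=\theta^Tx$, $\#$ the push-forward and $\mathrm{W}_2$ the 2-Wasserstein distance, for directions $\theta_1,\dots,\theta_p$ in the unit sphere $\mathbb{S}^{d-1}$, $\mathcal{E}_p(Y):=\frac1p\sum_{i=1}^p\mathrm{W}_2^2(P_{\theta_i}\#\gamma_Y,P_{\theta_i}\#\gamma_Z)$. $\|\cdot\|_F$ is the Frobenius norm, i.e. the Euclidean norm on $\mathbb{R}^{n\times d}$. *)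

theory Defs
  imports "HOL-Probability.Probability"
begin

text \<open>
  A matrix \<open>Y\<close> with \<open>n\<close> rows in \<open>d\<close>-space is an element of \<open>real ^ 'd ^ 'n\<close>, with
  \<open>n = CARD('n)\<close> and \<open>d = CARD('d)\<close>; the row \<open>y\<^sub>k\<close> is \<open>Y $ k\<close>, and \<open>norm Y\<close> is the
  Frobenius norm, see \<open>norm_matrix_frobenius\<close>.
\<close>

definition empirical_measure :: "real ^ 'd ^ 'n \<Rightarrow> (real ^ 'd) measure" where
  "empirical_measure Y =
     measure_of UNIV (sets borel)
       (\<lambda>A. ennreal (1 / real CARD('n)) * (\<Sum>k\<in>UNIV. emeasure (return borel (Y $ k)) A))"

definition couplings ::
    "'a::metric_space measure \<Rightarrow> 'a measure \<Rightarrow> ('a \<times> 'a) measure set" where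
  "couplings \<mu> \<nu> =
     {\<pi>. sets \<pi> = sets (borel \<Otimes>\<^sub>M borel) \<and> distr \<pi> borel fst = \<mu> \<and> distr \<pi> borel snd = \<nu>}"

text \<open>
  The infimum is finite for Borel probability measures with finite second moment, the only
  ones to which the distance is meant to be applied; otherwise \<^term>\<open>enn2real\<close> may
  send \<open>\<infinity>\<close> to \<open>0\<close>.
\<close>

definition wasserstein2 ::
    "'a::{metric_space, second_countable_topology} measure \<Rightarrow> 'a measure \<Rightarrow> real" where
  "wasserstein2 \<mu> \<nu> =
     sqrt (enn2real (INF \<pi>\<in>couplings \<mu> \<nu>. \<integral>\<^sup>+ z. ennreal ((dist (fst z) (snd z))\<^sup>2) \<partial>\<pi>))"

definition proj :: "real ^ 'd \<Rightarrow> real ^ 'd \<Rightarrow> real" where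
  "proj \<theta> x = \<theta> \<bullet> x"

definition sliced_energy ::
    "nat \<Rightarrow> (nat \<Rightarrow> real ^ 'd) \<Rightarrow> real ^ 'd ^ 'n \<Rightarrow> real ^ 'd ^ 'n \<Rightarrow> real" where
  "sliced_energy p \<theta> Z Y =
     1 / real p * (\<Sum>i = 1..p.
       (wasserstein2 (distr (empirical_measure Y) borel (proj (\<theta> i)))
                     (distr (empirical_measure Z) borel (proj (\<theta> i))))\<^sup>2)"

definition semi_concave :: "real \<Rightarrow> ('a::real_normed_vector \<Rightarrow> real) \<Rightarrow> bool" where
  "semi_concave c f \<longleftrightarrow> concave_on UNIV (\<lambda>x. f x - c * (norm x)\<^sup>2)"

lemma norm_matrix_frobenius:
  fixes Y :: "real ^ 'd ^ 'n"
  shows "norm Y = sqrt (\<Sum>k\<in>UNIV. \<Sum>j\<in>UNIV. (Y $ k $ j)\<^sup>2)"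
  by (simp add: norm_vec_def L2_set_def real_sqrt_pow2 sum_nonneg)

lemma space_empirical_measure [simp]: "space (empirical_measure Y) = UNIV"
  by (simp add: empirical_measure_def space_measure_of_conv)

lemma sets_empirical_measure [simp, measurable_cong]: "sets (empirical_measure Y) = sets borel"
  using sets.sigma_sets_eq[of "borel :: (real ^ 'd) measure"]
  by (simp add: empirical_measure_def sets_measure_of_conv)

text \<open>The set function in \<open>empirical_measure\<close> is a measure, so \<open>measure_of\<close> keeps it.\<close>

lemma emeasure_empirical_measure:
  fixes Y :: "real ^ 'd ^ 'n"
  assumes A: "A \<in> sets borel"
  shows "emeasure (empirical_measure Y) A =
    ennreal (1 / real CARD('n)) * (\<Sum>k\<in>UNIV. emeasure (return borel (Y $ k)) A)"
proof -
  let ?f = "\<lambda>A. ennreal (1 / real CARD('n)) * (\<Sum>k\<in>UNIV. emeasure (return borel (Y $ k)) A)"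
  have "countably_additive (sets borel) ?f"
  proof (rule countably_additiveI)
    fix B :: "nat \<Rightarrow> (real ^ 'd) set"
    assume B: "range B \<subseteq> sets borel" "disjoint_family B"
    have s: "(\<Sum>i. emeasure (return borel (Y $ k)) (B i)) = emeasure (return borel (Y $ k)) (\<Union>i. B i)" for k
      using B by (intro suminf_emeasure) auto
    have "(\<Sum>i. ?f (B i)) = ennreal (1 / real CARD('n)) *
        (\<Sum>k\<in>UNIV. \<Sum>i. emeasure (return borel (Y $ k)) (B i))"
      by (simp only: ennreal_suminf_cmult suminf_sum[OF summableI])
    then show "(\<Sum>i. ?f (B i)) = ?f (\<Union>i. B i)"
      by (simp only: s)
  qed
  moreover have "positive (sets borel) ?f"
    by (simp add: positive_def)
  moreover have "sigma_algebra UNIV (sets (borel :: (real ^ 'd) measure))"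
    using sets.sigma_algebra_axioms[of "borel :: (real ^ 'd) measure"] by simp
  ultimately show ?thesis
    unfolding empirical_measure_def using A by (intro emeasure_measure_of_sigma)
qed

lemma prob_space_empirical_measure:
  fixes Y :: "real ^ 'd ^ 'n"
  shows "prob_space (empirical_measure Y)"
proof (rule prob_spaceI)
  show "emeasure (empirical_measure Y) (space (empirical_measure Y)) = 1"
    by (simp add: emeasure_empirical_measure ennreal_of_nat_eq_real_of_nat
        flip: ennreal_mult)
qed

end

theory Submission
  imports Defs
begin

text \<open>
  The squared distance between the uniform measures on two families of \<open>n\<close> points is the infimum,
  over \<open>n \<times> n\<close> matrices \<open>w\<close> with nonnegative entries and all row and column sums \<open>1/n\<close>, of the
  transport cost of \<open>w\<close>. The set of these \<open>w\<close> does not depend on \<open>Y\<close>, and for a fixed \<open>w\<close> the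
  cost is a quadratic function of \<open>Y\<close> with quadratic part \<open>(1/n) \<Sum>\<^sub>k (\<theta> \<bullet> y\<^sub>k)\<^sup>2\<close>, which is at most
  \<open>\<parallel>Y\<parallel>\<^sup>2 / n\<close> by Cauchy--Schwarz. Hence the energy minus \<open>\<parallel>Y\<parallel>\<^sup>2 / n\<close> is an average of infima of
  concave functions.
\<close>

section \<open>Discrete transport plans and uniform measures on finite families of points\<close>

definition transport_plans :: "('n::finite \<Rightarrow> 'n \<Rightarrow> real) set" where
  "transport_plans = {w. (\<forall>k l. 0 \<le> w k l) \<and>
     (\<forall>k. (\<Sum>l\<in>UNIV. w k l) = 1 / real CARD('n)) \<and>
     (\<forall>l. (\<Sum>k\<in>UNIV. w k l) = 1 / real CARD('n))}"

definition transport_cost ::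
    "('n::finite \<Rightarrow> 'n \<Rightarrow> real) \<Rightarrow> ('n \<Rightarrow> 'a::metric_space) \<Rightarrow> ('n \<Rightarrow> 'a) \<Rightarrow> real" where
  "transport_cost w a b = (\<Sum>k\<in>UNIV. \<Sum>l\<in>UNIV. w k l * (dist (a k) (b l))\<^sup>2)"

text \<open>Using an indexed family instead of a set of points lets repeated values carry mass
  according to their multiplicity; projections of distinct rows may coincide.\<close>

definition uniform_points :: "('n::finite \<Rightarrow> 'a::topological_space) \<Rightarrow> 'a measure" where
  "uniform_points a = distr (uniform_count_measure UNIV) borel a"

lemma sets_uniform_points [simp, measurable_cong]: "sets (uniform_points a) = sets borel"
  by (simp add: uniform_points_def)

lemma emeasure_uniform_points:
  fixes a :: "'n::finite \<Rightarrow> 'a::topological_space"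
  assumes "A \<in> sets borel"
  shows "emeasure (uniform_points a) A = ennreal (1 / real CARD('n) * real (card {k. a k \<in> A}))"
proof -
  have "emeasure (uniform_points a) A = emeasure (uniform_count_measure (UNIV :: 'n set)) {k. a k \<in> A}"
    using assms by (simp add: uniform_points_def emeasure_distr vimage_def space_uniform_count_measure
        measurable_def sets_uniform_count_measure)
  then show ?thesis
    by (simp add: emeasure_uniform_count_measure)
qed

text \<open>This turns each slice of the energy into a transport problem between two families of
  reals over the fixed index type \<open>'n\<close>, so that the admissible plans do not change with
  \<open>Y\<close>.\<close>

lemma distr_proj_empirical_measure:
  fixes Y :: "real ^ 'd ^ 'n"
  shows "distr (empirical_measure Y) borel (proj \<theta>) = uniform_points (\<lambda>k. \<theta> \<bullet> Y $ k)"
proof (rule measure_eqI)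
  fix A assume "A \<in> sets (distr (empirical_measure Y) borel (proj \<theta>))"
  then have A[measurable]: "A \<in> sets borel" by simp
  have [measurable]: "proj \<theta> \<in> borel_measurable borel"
    unfolding proj_def[abs_def] by measurable
  have m: "proj \<theta> \<in> measurable (empirical_measure Y) borel"
    by measurable
  have pre: "proj \<theta> -` A \<in> sets borel"
    using measurable_sets[of "proj \<theta>" borel borel A] by simp
  have "emeasure (distr (empirical_measure Y) borel (proj \<theta>)) A
      = ennreal (1 / real CARD('n)) * (\<Sum>k\<in>UNIV. indicator A (\<theta> \<bullet> Y $ k))"
    using pre by (simp add: emeasure_distr[OF m A] emeasure_empirical_measure indicator_def proj_def)
  also have "(\<Sum>k\<in>UNIV. indicator A (\<theta> \<bullet> Y $ k)) = ennreal (real (card {k. \<theta> \<bullet> Y $ k \<in> A}))"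
    by (simp add: indicator_def sum.If_cases ennreal_of_nat_eq_real_of_nat)
  finally show "emeasure (distr (empirical_measure Y) borel (proj \<theta>)) A
      = emeasure (uniform_points (\<lambda>k. \<theta> \<bullet> Y $ k)) A"
    by (simp add: emeasure_uniform_points flip: ennreal_mult)
qed simp

section \<open>From transport plans to couplings\<close>

text \<open>A plan is a measure on pairs of indices; pushing it to pairs of points gives a coupling,
  because the marginal mass of \<open>A\<close> is a sum of full rows (or columns) over the indices
  whose point lies in \<open>A\<close>, each contributing 1/n.\<close>

lemma distr_transport_plan_marginals:
  fixes a b :: "'n::finite \<Rightarrow> 'a::{metric_space, second_countable_topology}"
  assumes w: "w \<in> transport_plans"
  shows "distr (point_measure UNIV (\<lambda>(k, l). ennreal (w k l))) (borel \<Otimes>\<^sub>M borel) (\<lambda>(k, l). (a k, b l))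
      \<in> couplings (uniform_points a) (uniform_points b)"
proof -
  let ?P = "point_measure UNIV (\<lambda>(k, l). ennreal (w k l)) :: ('n \<times> 'n) measure"
  have [simp]: "f \<in> measurable ?P N" if "\<And>x. f x \<in> space N" for f and N :: "'b measure"
    using that by (auto simp: measurable_def sets_point_measure space_point_measure)
  have w0: "0 \<le> w k l" and row: "(\<Sum>l\<in>UNIV. w k l) = 1 / real CARD('n)"
    and col: "(\<Sum>k\<in>UNIV. w k l) = 1 / real CARD('n)" for k l
    using w by (auto simp: transport_plans_def)
  have eP: "emeasure ?P S = ennreal (\<Sum>(k, l)\<in>S. w k l)" for S
    by (subst emeasure_point_measure_finite) (auto simp: w0 case_prod_unfold)
  have "distr ?P borel (\<lambda>x. a (fst x)) = uniform_points a"
  proof (rule measure_eqI)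
    fix A assume "A \<in> sets (distr ?P borel (\<lambda>x. a (fst x)))"
    then have A: "A \<in> sets borel" by simp
    have "(\<lambda>x. a (fst x)) -` A \<inter> space ?P = {k. a k \<in> A} \<times> UNIV"
      by (auto simp: space_point_measure)
    then show "emeasure (distr ?P borel (\<lambda>x. a (fst x))) A = emeasure (uniform_points a) A"
      using A by (simp add: emeasure_distr eP emeasure_uniform_points row
          flip: sum.cartesian_product)
  qed simp
  moreover have "distr ?P borel (\<lambda>x. b (snd x)) = uniform_points b"
  proof (rule measure_eqI)
    fix A assume "A \<in> sets (distr ?P borel (\<lambda>x. b (snd x)))"
    then have A: "A \<in> sets borel" by simp
    have "(\<lambda>x. b (snd x)) -` A \<inter> space ?P = UNIV \<times> {k. b k \<in> A}"
      by (auto simp: space_point_measure)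
    moreover have "(\<Sum>(k, l)\<in>UNIV \<times> {k. b k \<in> A}. w k l) = (\<Sum>l\<in>{k. b k \<in> A}. \<Sum>k\<in>UNIV. w k l)"
      by (subst sum.swap) (simp add: sum.cartesian_product)
    ultimately show "emeasure (distr ?P borel (\<lambda>x. b (snd x))) A = emeasure (uniform_points b) A"
      using A by (simp add: emeasure_distr eP emeasure_uniform_points col)
  qed simp
  ultimately show ?thesis
    by (auto simp: couplings_def distr_distr space_pair_measure comp_def case_prod_unfold)
qed

lemma INF_couplings_le_transport_cost:
  fixes a b :: "'n::finite \<Rightarrow> 'a::{metric_space, second_countable_topology}"
  assumes w: "w \<in> transport_plans"
  shows "(INF \<pi>\<in>couplings (uniform_points a) (uniform_points b).
      \<integral>\<^sup>+ z. ennreal ((dist (fst z) (snd z))\<^sup>2) \<partial>\<pi>) \<le> ennreal (transport_cost w a b)"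
proof (rule INF_lower2[OF distr_transport_plan_marginals[OF w]])
  let ?P = "point_measure UNIV (\<lambda>(k, l). ennreal (w k l)) :: ('n \<times> 'n) measure"
  have w0: "0 \<le> w k l" for k l
    using w by (auto simp: transport_plans_def)
  have m: "(\<lambda>(k, l). (a k, b l)) \<in> measurable ?P (borel \<Otimes>\<^sub>M borel)"
    by (auto simp: measurable_def sets_point_measure space_point_measure space_pair_measure)
  have "(\<integral>\<^sup>+ z. ennreal ((dist (fst z) (snd z))\<^sup>2) \<partial>distr ?P (borel \<Otimes>\<^sub>M borel) (\<lambda>(k, l). (a k, b l)))
      = (\<integral>\<^sup>+ x. ennreal ((dist (a (fst x)) (b (snd x)))\<^sup>2) \<partial>?P)"
    by (subst nn_integral_distr[OF m]) (auto simp: case_prod_unfold)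
  also have "\<dots> = ennreal (\<Sum>(k, l)\<in>UNIV. w k l * (dist (a k) (b l))\<^sup>2)"
    by (subst nn_integral_point_measure_finite)
      (auto simp: w0 case_prod_unfold ennreal_mult[symmetric] mult.commute)
  also have "(\<Sum>(k, l)\<in>UNIV. w k l * (dist (a k) (b l))\<^sup>2) = transport_cost w a b"
    by (simp add: transport_cost_def sum.cartesian_product)
  finally show "(\<integral>\<^sup>+ z. ennreal ((dist (fst z) (snd z))\<^sup>2)
      \<partial>distr ?P (borel \<Otimes>\<^sub>M borel) (\<lambda>(k, l). (a k, b l))) \<le> ennreal (transport_cost w a b)"
    by simp
qed

section \<open>From couplings to transport plans\<close>

text \<open>All indices in the fibre over \<open>x\<close> contribute equal shares of
  \<open>f x\<close>, and the number of shares is the size of the fibre. This converts sums over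
  indices into sums over points.\<close>

lemma sum_divide_card_fibre:
  fixes a :: "'n::finite \<Rightarrow> 'a" and f :: "'a \<Rightarrow> real"
  shows "(\<Sum>k\<in>UNIV. f (a k) / real (card {j. a j = a k})) = (\<Sum>x\<in>range a. f x)"
proof -
  have "(\<Sum>k\<in>UNIV. f (a k) / real (card {j. a j = a k}))
      = (\<Sum>x\<in>range a. \<Sum>k\<in>{k. a k = x}. f (a k) / real (card {j. a j = a k}))"
    using sum.image_gen[of UNIV "\<lambda>k. f (a k) / real (card {j. a j = a k})" a] by simp
  also have "\<dots> = (\<Sum>x\<in>range a. f x)"
  proof (rule sum.cong[OF refl])
    fix x assume "x \<in> range a"
    then have "card {j. a j = x} \<noteq> 0" by auto
    then show "(\<Sum>k\<in>{k. a k = x}. f (a k) / real (card {j. a j = a k})) = f x" by simp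
  qed
  finally show ?thesis .
qed

text \<open>A coupling only sees the points, not their indices; its mass at a pair of points is shared
  equally among all pairs of indices representing this pair.\<close>

lemma transport_plan_of_coupling:
  fixes a b :: "'n::finite \<Rightarrow> 'a::{metric_space, second_countable_topology}"
  assumes \<pi>: "\<pi> \<in> couplings (uniform_points a) (uniform_points b)"
  obtains w where "w \<in> transport_plans"
    "ennreal (transport_cost w a b) \<le> (\<integral>\<^sup>+ z. ennreal ((dist (fst z) (snd z))\<^sup>2) \<partial>\<pi>)"
proof -
  have sets [measurable_cong]: "sets \<pi> = sets (borel \<Otimes>\<^sub>M borel)"
    and d1: "distr \<pi> borel fst = uniform_points a" and d2: "distr \<pi> borel snd = uniform_points b"
    using \<pi> by (auto simp: couplings_def)
  have sp: "space \<pi> = UNIV"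
    using sets_eq_imp_space_eq[OF sets] by (simp add: space_pair_measure)
  have rect: "A \<times> B \<in> sets \<pi>" if "A \<in> sets borel" "B \<in> sets borel" for A B
    using that unfolding sets by (rule pair_measureI)
  have pt: "{z} \<in> sets \<pi>" for z :: "'a \<times> 'a"
    using sets_Pair[of "fst z" borel "snd z" borel] by (simp add: sets)
  have e1: "emeasure \<pi> (A \<times> UNIV) = ennreal (1 / real CARD('n) * real (card {k. a k \<in> A}))"
    if "A \<in> sets borel" for A
  proof -
    have "emeasure \<pi> (A \<times> UNIV) = emeasure (distr \<pi> borel fst) A"
      using that by (subst emeasure_distr) (auto simp: sp intro!: arg_cong[where f = "emeasure \<pi>"])
    then show ?thesis
      using that by (simp add: d1 emeasure_uniform_points)
  qed
  have e2: "emeasure \<pi> (UNIV \<times> B) = ennreal (1 / real CARD('n) * real (card {k. b k \<in> B}))"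
    if "B \<in> sets borel" for B
  proof -
    have "emeasure \<pi> (UNIV \<times> B) = emeasure (distr \<pi> borel snd) B"
      using that by (subst emeasure_distr) (auto simp: sp intro!: arg_cong[where f = "emeasure \<pi>"])
    then show ?thesis
      using that by (simp add: d2 emeasure_uniform_points)
  qed
  have "emeasure \<pi> (space \<pi>) \<noteq> \<infinity>"
    using e1[of UNIV] by (simp add: sp)
  then interpret finite_measure \<pi>
    by (rule finite_measureI)
  have fin: "finite S \<Longrightarrow> S \<in> sets borel" for S :: "'a set"
    by (intro borel_closed finite_imp_closed)
  \<comment> \<open>Both marginals live on finite sets, so the coupling is carried by
    \<open>range a \<times> range b\<close>, even though it is a measure on the whole
    product.\<close>
  have n1: "emeasure \<pi> ((- range a) \<times> UNIV) = 0"
    using e1[of "- range a"] fin[of "range a"] by (simp add: borel_comp)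
  have n2: "emeasure \<pi> (UNIV \<times> (- range b)) = 0"
    using e2[of "- range b"] fin[of "range b"] by (simp add: borel_comp)
  \<comment> \<open>Up to a null set the slice over \<open>x\<close> is a finite union of points,
    and its mass is prescribed by the first marginal. The argument for \<open>col\<close> is
    symmetric.\<close>
  have row: "(\<Sum>y\<in>range b. measure \<pi> {(x, y)}) = 1 / real CARD('n) * real (card {j. a j = x})" for x
  proof -
    have "(\<Sum>y\<in>range b. measure \<pi> {(x, y)}) = measure \<pi> (\<Union>y\<in>range b. {(x, y)})"
      by (rule finite_measure_finite_Union[symmetric]) (auto simp: disjoint_family_on_def pt)
    also have "(\<Union>y\<in>range b. {(x, y)}) = {x} \<times> range b"
      by auto
    also have "measure \<pi> ({x} \<times> range b) = measure \<pi> ({x} \<times> UNIV)"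
    proof (rule measure_eq_AE)
      have "AE z in \<pi>. z \<notin> UNIV \<times> (- range b)"
        using n2 fin[of "range b"] by (intro AE_not_in) (auto simp: null_sets_def borel_comp)
      then show "AE z in \<pi>. z \<in> {x} \<times> range b \<longleftrightarrow> z \<in> {x} \<times> UNIV"
        by eventually_elim auto
    qed (intro rect; simp add: fin)+
    also have "\<dots> = 1 / real CARD('n) * real (card {j. a j = x})"
      using e1[of "{x}"] by (simp add: measure_def)
    finally show ?thesis .
  qed
  have col: "(\<Sum>x\<in>range a. measure \<pi> {(x, y)}) = 1 / real CARD('n) * real (card {j. b j = y})" for y
  proof -
    have "(\<Sum>x\<in>range a. measure \<pi> {(x, y)}) = measure \<pi> (\<Union>x\<in>range a. {(x, y)})"
      by (rule finite_measure_finite_Union[symmetric]) (auto simp: disjoint_family_on_def pt)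
    also have "(\<Union>x\<in>range a. {(x, y)}) = range a \<times> {y}"
      by auto
    also have "measure \<pi> (range a \<times> {y}) = measure \<pi> (UNIV \<times> {y})"
    proof (rule measure_eq_AE)
      have "AE z in \<pi>. z \<notin> (- range a) \<times> UNIV"
        using n1 fin[of "range a"] by (intro AE_not_in) (auto simp: null_sets_def borel_comp)
      then show "AE z in \<pi>. z \<in> range a \<times> {y} \<longleftrightarrow> z \<in> UNIV \<times> {y}"
        by eventually_elim auto
    qed (intro rect; simp add: fin)+
    also have "\<dots> = 1 / real CARD('n) * real (card {j. b j = y})"
      using e2[of "{y}"] by (simp add: measure_def)
    finally show ?thesis .
  qed
  \<comment> \<open>The two successive divisions allow \<open>sum_divide_card_fibre\<close> to be
    applied separately in \<open>l\<close> and in \<open>k\<close>; the fibre size appearing in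
    \<open>row\<close> or \<open>col\<close> then cancels the remaining division.\<close>
  define w where "w k l = measure \<pi> {(a k, b l)} / real (card {j. b j = b l}) / real (card {j. a j = a k})"
    for k l
  have na: "card {j. a j = a k} \<noteq> 0" for k by auto
  have nb: "card {j. b j = b l} \<noteq> 0" for l by auto
  have "(\<Sum>l\<in>UNIV. w k l) = 1 / real CARD('n)" for k
    using na[of k] sum_divide_card_fibre[of "\<lambda>y. measure \<pi> {(a k, y)}" b]
    unfolding w_def by (simp only: row flip: sum_divide_distrib) simp
  moreover have "(\<Sum>k\<in>UNIV. w k l) = 1 / real CARD('n)" for l
    using nb[of l] sum_divide_card_fibre[of "\<lambda>x. measure \<pi> {(x, b l)} / real (card {j. b j = b l})" a]
    unfolding w_def by (simp only: col sum_divide_distrib[symmetric]) simp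
  ultimately have plan: "w \<in> transport_plans"
    by (auto simp: transport_plans_def w_def)
  have "transport_cost w a b = (\<Sum>k\<in>UNIV. (\<Sum>l\<in>UNIV. measure \<pi> {(a k, b l)} * (dist (a k) (b l))\<^sup>2
      / real (card {j. b j = b l})) / real (card {j. a j = a k}))"
    by (simp add: transport_cost_def w_def sum_divide_distrib mult.commute)
  also have "\<dots> = (\<Sum>k\<in>UNIV. (\<Sum>y\<in>range b. measure \<pi> {(a k, y)} * (dist (a k) y)\<^sup>2)
      / real (card {j. a j = a k}))"
    by (simp only: sum_divide_card_fibre[of "\<lambda>y. measure \<pi> {(_, y)} * (dist _ y)\<^sup>2" b])
  also have "\<dots> = (\<Sum>x\<in>range a. \<Sum>y\<in>range b. measure \<pi> {(x, y)} * (dist x y)\<^sup>2)"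
    by (rule sum_divide_card_fibre)
  also have "\<dots> = (\<Sum>z\<in>range a \<times> range b. measure \<pi> {z} * (dist (fst z) (snd z))\<^sup>2)"
    by (simp add: sum.cartesian_product case_prod_unfold)
  finally have "ennreal (transport_cost w a b)
      = (\<Sum>z\<in>range a \<times> range b. ennreal ((dist (fst z) (snd z))\<^sup>2) * emeasure \<pi> {z})"
    by (simp add: emeasure_eq_measure mult.commute flip: ennreal_mult)
  also have "\<dots> = (\<integral>\<^sup>+ z. (\<Sum>u\<in>range a \<times> range b. ennreal ((dist (fst u) (snd u))\<^sup>2) * indicator {u} z) \<partial>\<pi>)"
    using pt by (subst nn_integral_sum) (auto simp: nn_integral_cmult_indicator)
  \<comment> \<open>At each \<open>z\<close> at most one indicator is nonzero, so the finite sum is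
    bounded by the cost at \<open>z\<close>. An inequality is enough for comparing infima.\<close>
  also have "\<dots> \<le> (\<integral>\<^sup>+ z. ennreal ((dist (fst z) (snd z))\<^sup>2) \<partial>\<pi>)"
  proof (rule nn_integral_mono)
    fix z
    have "(\<Sum>u\<in>range a \<times> range b. ennreal ((dist (fst u) (snd u))\<^sup>2) * indicator {u} z)
        = (\<Sum>u\<in>range a \<times> range b. if u = z then ennreal ((dist (fst z) (snd z))\<^sup>2) else 0)"
      by (rule sum.cong) (auto simp: indicator_def)
    then show "(\<Sum>u\<in>range a \<times> range b. ennreal ((dist (fst u) (snd u))\<^sup>2) * indicator {u} z)
        \<le> ennreal ((dist (fst z) (snd z))\<^sup>2)"
      by simp
  qed
  finally show thesis
    using plan that by blast
qed

section \<open>The squared Wasserstein distance as an infimum over plans\<close>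

lemma transport_cost_nonneg: "w \<in> transport_plans \<Longrightarrow> 0 \<le> transport_cost w a b"
  by (auto simp: transport_cost_def transport_plans_def intro!: sum_nonneg)

lemma wasserstein2_power2:
  "(wasserstein2 \<mu> \<nu>)\<^sup>2
    = enn2real (INF \<pi>\<in>couplings \<mu> \<nu>. \<integral>\<^sup>+ z. ennreal ((dist (fst z) (snd z))\<^sup>2) \<partial>\<pi>)"
  by (simp add: wasserstein2_def)

lemma wasserstein2_le_transport_cost:
  fixes a b :: "'n::finite \<Rightarrow> 'a::{metric_space, second_countable_topology}"
  assumes "w \<in> transport_plans"
  shows "(wasserstein2 (uniform_points a) (uniform_points b))\<^sup>2 \<le> transport_cost w a b"
  unfolding wasserstein2_power2
  by (rule enn2real_leI[OF transport_cost_nonneg[OF assms] INF_couplings_le_transport_cost[OF assms]])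

lemma wasserstein2_greatest:
  fixes a b :: "'n::finite \<Rightarrow> 'a::{metric_space, second_countable_topology}"
  assumes "\<And>w. w \<in> transport_plans \<Longrightarrow> c \<le> transport_cost w a b"
  shows "c \<le> (wasserstein2 (uniform_points a) (uniform_points b))\<^sup>2"
proof -
  let ?I = "INF \<pi>\<in>couplings (uniform_points a) (uniform_points b).
      \<integral>\<^sup>+ z. ennreal ((dist (fst z) (snd z))\<^sup>2) \<partial>\<pi>"
  \<comment> \<open>The product plan shows that the infimum is finite, so \<open>enn2real\<close>
    does not collapse it to 0.\<close>
  have "(\<lambda>k l. 1 / (real CARD('n))\<^sup>2) \<in> (transport_plans :: ('n \<Rightarrow> 'n \<Rightarrow> real) set)"
    by (simp add: transport_plans_def power2_eq_square)
  from INF_couplings_le_transport_cost[OF this, of a b] have "?I < \<top>"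
    by (rule le_less_trans) simp
  moreover have "ennreal c \<le> ?I"
  proof (rule INF_greatest)
    fix \<pi> assume "\<pi> \<in> couplings (uniform_points a) (uniform_points b)"
    then obtain w where "w \<in> transport_plans" and
      le: "ennreal (transport_cost w a b) \<le> (\<integral>\<^sup>+ z. ennreal ((dist (fst z) (snd z))\<^sup>2) \<partial>\<pi>)"
      by (rule transport_plan_of_coupling)
    then have "ennreal c \<le> ennreal (transport_cost w a b)"
      by (intro ennreal_leI assms)
    then show "ennreal c \<le> (\<integral>\<^sup>+ z. ennreal ((dist (fst z) (snd z))\<^sup>2) \<partial>\<pi>)"
      using le by (rule order_trans)
  qed
  ultimately have "ennreal c \<le> ennreal (enn2real ?I)"
    by (simp add: ennreal_enn2real)
  \<comment> \<open>\<open>c\<close> may be negative, in which case \<open>ennreal c\<close> is 0;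
    the real inequality still follows because the value of \<open>enn2real\<close> is
    nonnegative.\<close>
  then show ?thesis
    unfolding wasserstein2_power2 by (subst (asm) ennreal_le_iff) simp_all
qed

section \<open>Transport costs along a segment\<close>

text \<open>Each squared distance is quadratic in the moving point with leading coefficient 1, so
  its defect from linear interpolation is \<open>t * (1 - t) * (a k - a' k)\<^sup>2\<close>,
  whatever the target \<open>b l\<close>. The row sums 1/n then make the total defect independent of
  \<open>w\<close>.\<close>

lemma transport_cost_convex_combination:
  fixes a a' b :: "'n::finite \<Rightarrow> real"
  assumes w: "w \<in> transport_plans"
  shows "transport_cost w (\<lambda>k. (1 - t) * a k + t * a' k) b
    = (1 - t) * transport_cost w a b + t * transport_cost w a' b
      - t * (1 - t) / real CARD('n) * (\<Sum>k\<in>UNIV. (a k - a' k)\<^sup>2)"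
proof -
  have row: "(\<Sum>l\<in>UNIV. w k l) = 1 / real CARD('n)" for k
    using w by (auto simp: transport_plans_def)
  have "transport_cost w (\<lambda>k. (1 - t) * a k + t * a' k) b
    = (\<Sum>k\<in>UNIV. \<Sum>l\<in>UNIV. (1 - t) * (w k l * (dist (a k) (b l))\<^sup>2)
        + t * (w k l * (dist (a' k) (b l))\<^sup>2) - t * (1 - t) * (a k - a' k)\<^sup>2 * w k l)"
    unfolding transport_cost_def
    by (intro sum.cong refl) (simp add: dist_real_def power2_eq_square algebra_simps)
  also have "\<dots> = (1 - t) * transport_cost w a b + t * transport_cost w a' b
      - (\<Sum>k\<in>UNIV. t * (1 - t) * (a k - a' k)\<^sup>2 * (\<Sum>l\<in>UNIV. w k l))"
    by (simp add: transport_cost_def sum.distrib sum_subtractf sum_distrib_left)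
  finally show ?thesis
    by (simp add: row sum_distrib_left)
qed

text \<open>As the defect is the same for every plan, the bound can be proved plan by plan: one
  \<open>w\<close> for the interpolated points is a competitor for both endpoints, and the infimum
  over \<open>w\<close> is taken last.\<close>

lemma wasserstein2_convex_combination:
  fixes a a' b :: "'n::finite \<Rightarrow> real"
  assumes t: "0 \<le> t" "t \<le> 1"
  shows "(1 - t) * (wasserstein2 (uniform_points a) (uniform_points b))\<^sup>2
      + t * (wasserstein2 (uniform_points a') (uniform_points b))\<^sup>2
      - t * (1 - t) / real CARD('n) * (\<Sum>k\<in>UNIV. (a k - a' k)\<^sup>2)
    \<le> (wasserstein2 (uniform_points (\<lambda>k. (1 - t) * a k + t * a' k)) (uniform_points b))\<^sup>2"
proof (rule wasserstein2_greatest)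
  fix w :: "'n \<Rightarrow> 'n \<Rightarrow> real" assume w: "w \<in> transport_plans"
  show "(1 - t) * (wasserstein2 (uniform_points a) (uniform_points b))\<^sup>2
      + t * (wasserstein2 (uniform_points a') (uniform_points b))\<^sup>2
      - t * (1 - t) / real CARD('n) * (\<Sum>k\<in>UNIV. (a k - a' k)\<^sup>2)
    \<le> transport_cost w (\<lambda>k. (1 - t) * a k + t * a' k) b"
    unfolding transport_cost_convex_combination[OF w]
    using t by (intro diff_right_mono add_mono mult_left_mono wasserstein2_le_transport_cost[OF w]) auto
qed

section \<open>Semi-concavity of the sliced energy\<close>

lemma sum_inner_rows_le_norm:
  fixes V :: "real ^ 'd ^ 'n"
  assumes "norm \<theta> = 1"
  shows "(\<Sum>k\<in>UNIV. (\<theta> \<bullet> V $ k)\<^sup>2) \<le> (norm V)\<^sup>2"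
proof -
  have "(\<theta> \<bullet> V $ k)\<^sup>2 \<le> (norm (V $ k))\<^sup>2" for k
    using Cauchy_Schwarz_ineq2[of \<theta> "V $ k"] assms by (simp add: abs_le_square_iff[symmetric])
  then show ?thesis
    by (simp add: norm_vec_def L2_set_def sum_nonneg sum_mono)
qed

text \<open>The defect of the squared norm has the same shape as that of the transport cost, which
  is what allows the two to be compared.\<close>

lemma norm_convex_combination:
  fixes x y :: "'a::real_inner"
  shows "(norm ((1 - t) *\<^sub>R x + t *\<^sub>R y))\<^sup>2
    = (1 - t) * (norm x)\<^sup>2 + t * (norm y)\<^sup>2 - t * (1 - t) * (norm (x - y))\<^sup>2"
  unfolding power2_norm_eq_inner
  by (simp add: algebra_simps inner_commute)

theorem proposition2p3:
  fixes Z :: "real ^ 'd ^ 'n" and \<theta> :: "nat \<Rightarrow> real ^ 'd" and p :: nat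
  assumes "p \<ge> 1"
    and "\<And>i. i \<in> {1..p} \<Longrightarrow> \<theta> i \<in> sphere 0 1"
  shows "semi_concave (1 / real CARD('n)) (sliced_energy p \<theta> Z)"
proof -
  let ?E = "sliced_energy p \<theta> Z"
  let ?N = "real CARD('n)"
  define W where "W i Y = (wasserstein2 (uniform_points (\<lambda>k. \<theta> i \<bullet> Y $ k))
      (uniform_points (\<lambda>k. \<theta> i \<bullet> Z $ k)))\<^sup>2" for i and Y :: "real ^ 'd ^ 'n"
  have E: "?E Y = (\<Sum>i = 1..p. W i Y) / real p" for Y
    by (simp add: sliced_energy_def W_def distr_proj_empirical_measure)
  have "(1 - t) * (?E X - 1 / ?N * (norm X)\<^sup>2) + t * (?E Y - 1 / ?N * (norm Y)\<^sup>2)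
      \<le> ?E ((1 - t) *\<^sub>R X + t *\<^sub>R Y) - 1 / ?N * (norm ((1 - t) *\<^sub>R X + t *\<^sub>R Y))\<^sup>2"
    if t: "0 < t" "t < 1" for t and X Y :: "real ^ 'd ^ 'n"
  proof -
    \<comment> \<open>\<open>?D\<close> is exactly the defect of the squared Frobenius norm divided
      by n; it remains to see that the energy has defect at most \<open>?D\<close>, first for each
      direction and then on average.\<close>
    let ?D = "t * (1 - t) / ?N * (norm (X - Y))\<^sup>2"
    have "(1 - t) * W i X + t * W i Y - ?D \<le> W i ((1 - t) *\<^sub>R X + t *\<^sub>R Y)" if "i \<in> {1..p}" for i
    proof -
      have "norm (\<theta> i) = 1" using assms(2)[OF that] by simp
      then have "t * (1 - t) / ?N * (\<Sum>k\<in>UNIV. (\<theta> i \<bullet> X $ k - \<theta> i \<bullet> Y $ k)\<^sup>2) \<le> ?D"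
        using t sum_inner_rows_le_norm[of "\<theta> i" "X - Y"]
        by (intro mult_left_mono) (auto simp: inner_diff_right)
      then show ?thesis
        using t wasserstein2_convex_combination[of t "\<lambda>k. \<theta> i \<bullet> X $ k" "\<lambda>k. \<theta> i \<bullet> Z $ k" "\<lambda>k. \<theta> i \<bullet> Y $ k"]
        by (simp add: W_def inner_add_right)
    qed
    then have "(\<Sum>i = 1..p. (1 - t) * W i X + t * W i Y - ?D)
        \<le> (\<Sum>i = 1..p. W i ((1 - t) *\<^sub>R X + t *\<^sub>R Y))"
      by (rule sum_mono)
    then have "(\<Sum>i = 1..p. (1 - t) * W i X + t * W i Y - ?D) / real p
        \<le> ?E ((1 - t) *\<^sub>R X + t *\<^sub>R Y)"
      unfolding E by (rule divide_right_mono) simp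
    \<comment> \<open>Since \<open>p\<close> is positive, averaging \<open>p\<close> copies of the
      constant \<open>?D\<close> returns \<open>?D\<close>.\<close>
    also have "(\<Sum>i = 1..p. (1 - t) * W i X + t * W i Y - ?D) / real p
        = (1 - t) * ?E X + t * ?E Y - ?D"
      using assms(1)
      by (simp add: E sum.distrib sum_subtractf diff_divide_distrib add_divide_distrib
          flip: sum_distrib_left)
    finally show ?thesis
      unfolding norm_convex_combination by (simp add: algebra_simps diff_divide_distrib add_divide_distrib)
  qed
  then show ?thesis
    unfolding semi_concave_def concave_on_def
    by (intro convex_onI) (simp_all add: algebra_simps)
qed

end
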